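(* Let $A$ be a uniform algebra on a compact Hausdorff space $\Omega$ and let $f\in C(\Omega)$ be strictly positive. Then: (a) $Af$ is a unitary subequivalence bimodule if and only if $f\in P\cap P^{-1}$, that is, if and only if $f\in P$ and $f^{-1}\in P$. (b) $Af$ is a strong subequivalence bimodule if and only if $f^2\in\mathcal{G}\cap\mathcal{G}^{-1}$, that is, $f^2\in\mathcal G$ and $f^{-2}\in\mathcal G$. (c) $f\in\overline{Q}^{+}$ if and only if $Af$ is a rank 1 strong Morita equivalence bimodule (with inverse bimodule $Af^{-1}$). (d) $f\in\mathcal{M}_A(\Omega)$ if and only if $Af$ is a strong Morita equivalence bimodule (with inverse bimodule $Af^{-1}$).
   Context: A uniform algebra on a compact Hausdorff space $\Omega$ is a closed subalgebra of $C(\Omega)$ (complex continuous functions) which contains the constants and separates points. $A^{-1}$ denotes the invertible elements of $A$, and $Af=\{af:a\in A\}\subset C(\Omega)$. Subsets of $C(\Omega)$: $P=\{|g|:g\in A\}$; $Q=\{|g|:g\in A^{-1}\}$; $\overline{Q}^{+}$ is the set of strictly positive functions in the uniform closure of $Q$; $\mathcal{F}=\{\sum_{i=1}^n|g_i|^2 : n\in\mathbb{N},\ g_1,\dots,g_n\in A\}$; $\mathcal{G}$ is the uniform closure of $\mathcal{F}$ in $C(\Omega)$. An $A$-tuple is an element $H=(h_1,\dots,h_n)$ of $A^{(n)}$ (for some $n$), regarded as a function $\Omega\to\mathbb{C}^n$; for $A$-tuples of the same length, $H\cdot K=\sum_i h_ik_i\in A$; $\|\cdot\|_2$ is the Euclidean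 norm. $\mathcal{M}_A(\Omega)$ is the set of strictly positive functions $f$ on $\Omega$ for which there are integers $m_n\in\mathbb{N}$ and $A$-tuples $H_n,K_n\in A^{(m_n)}$ with $H_n\cdot K_n=1$ for all $n$, such that $\|K_n(w)\|_2\to f(w)$ and $\|H_n(w)\|_2\to f(w)^{-1}$ uniformly on $\Omega$. Definitions, for strictly positive $f\in C(\Omega)$: - $Af$ is a strong Morita equivalence bimodule (with inverse bimodule $Af^{-1}$) if for every $\epsilon>0$ one can write $1=\sum_{i=1}^n x_iy_i$ on $\Omega$ for some $n$, with $x_i\in Af$, $y_i\in Af^{-1}$, and $\sum_{i=1}^n|x_i(\omega)|^2\le 1+\epsilon$ and $\sum_{i=1}^n|y_i(\omega)|^2\le1+\epsilon$ for all $\omega\in\Omega$. It is rank 1 if this can always be done with $n=1$. - $Af$ is a strong subequivalence bimodule if for every $\epsilon>0$ there are finitely many $x_i\in Af$, $y_i\in Af^{-1}$ with $1-\epsilon\le\sum_i|x_i(\omega)|^2\le1+\epsilon$ and $1-\epsilon\le\sum_i|y_i(\omega)|^2\le1+\epsilon$ for all $\omega\in\Omega$. - $Af$ is a unitary subequivalence bimodule if the condition for a strong subequivalence bimodule holds with $\epsilon=0$ and $n=1$ (a single $x\in Af$ and a single $y\in Af^{-1}$ with $|x|=|y|=1$ on $\Omega$). *)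

theory Defs
  imports "HOL-Analysis.Analysis"
begin

text \<open>
  The space \<open>\<Omega>\<close> is a topology \<open>X\<close> with carrier \<open>topspace X\<close>. A function on \<open>\<Omega>\<close> is represented by
  any total function on the ambient type, and only its values on \<open>topspace X\<close> matter: equations
  between functions are required on \<open>topspace X\<close> only, and all function sets below
  contain, with a function, every function that agrees with it on \<open>topspace X\<close> (for a uniform
  algebra this follows from closedness). Functions written as real valued in the
  mathematics (\<open>f\<close>, \<open>\<bar>g\<bar>\<close>, sums of squares) have real type.
\<close>

definition uniform_closure :: "'a topology \<Rightarrow> ('a \<Rightarrow> 'b::metric_space) set \<Rightarrow> ('a \<Rightarrow> 'b) set" where
  "uniform_closure X S =
     {f. continuous_map X euclidean f \<and>
         (\<forall>e>0. \<exists>g\<in>S. \<forall>w\<in>topspace X. dist (g w) (f w) < e)}"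

locale uniform_algebra =
  fixes X :: "'a topology" and A :: "('a \<Rightarrow> complex) set"
  assumes compact: "compact_space X"
    and Hausdorff: "Hausdorff_space X"
    and continuous: "\<And>g. g \<in> A \<Longrightarrow> continuous_map X euclidean g"
    and closed: "uniform_closure X A \<subseteq> A"
    and const: "\<And>c. (\<lambda>w. c) \<in> A"
    and add: "\<And>g h. g \<in> A \<Longrightarrow> h \<in> A \<Longrightarrow> (\<lambda>w. g w + h w) \<in> A"
    and scale: "\<And>c g. g \<in> A \<Longrightarrow> (\<lambda>w. c * g w) \<in> A"
    and mult: "\<And>g h. g \<in> A \<Longrightarrow> h \<in> A \<Longrightarrow> (\<lambda>w. g w * h w) \<in> A"
    and separates: "\<And>x y. x \<in> topspace X \<Longrightarrow> y \<in> topspace X \<Longrightarrow> x \<noteq> y \<Longrightarrow> \<exists>g\<in>A. g x \<noteq> g y"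

definition alg_units :: "'a topology \<Rightarrow> ('a \<Rightarrow> complex) set \<Rightarrow> ('a \<Rightarrow> complex) set" where
  "alg_units X A = {g \<in> A. \<exists>h\<in>A. \<forall>w\<in>topspace X. g w * h w = 1}"

definition strictly_positive :: "'a topology \<Rightarrow> ('a \<Rightarrow> real) \<Rightarrow> bool" where
  "strictly_positive X f \<longleftrightarrow> (\<forall>w\<in>topspace X. 0 < f w)"

definition P_set :: "'a topology \<Rightarrow> ('a \<Rightarrow> complex) set \<Rightarrow> ('a \<Rightarrow> real) set" where
  "P_set X A = {p. \<exists>g\<in>A. \<forall>w\<in>topspace X. p w = cmod (g w)}"

definition Q_set :: "'a topology \<Rightarrow> ('a \<Rightarrow> complex) set \<Rightarrow> ('a \<Rightarrow> real) set" where
  "Q_set X A = {q. \<exists>g\<in>alg_units X A. \<forall>w\<in>topspace X. q w = cmod (g w)}"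

definition Q_closure_pos :: "'a topology \<Rightarrow> ('a \<Rightarrow> complex) set \<Rightarrow> ('a \<Rightarrow> real) set" where
  "Q_closure_pos X A = {f \<in> uniform_closure X (Q_set X A). strictly_positive X f}"

definition F_set :: "'a topology \<Rightarrow> ('a \<Rightarrow> complex) set \<Rightarrow> ('a \<Rightarrow> real) set" where
  "F_set X A =
     {p. \<exists>(n::nat) g. (\<forall>i<n. g i \<in> A) \<and>
                      (\<forall>w\<in>topspace X. p w = (\<Sum>i<n. (cmod (g i w))\<^sup>2))}"

definition G_set :: "'a topology \<Rightarrow> ('a \<Rightarrow> complex) set \<Rightarrow> ('a \<Rightarrow> real) set" where
  "G_set X A = uniform_closure X (F_set X A)"

text \<open>An \<open>A\<close>-tuple of length \<open>n\<close> is a map \<open>H\<close> on indices, of which only the entries \<open>H i\<close>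
  with \<open>i < n\<close> are used.\<close>

definition is_tuple :: "('a \<Rightarrow> complex) set \<Rightarrow> nat \<Rightarrow> (nat \<Rightarrow> 'a \<Rightarrow> complex) \<Rightarrow> bool" where
  "is_tuple A n H \<longleftrightarrow> (\<forall>i<n. H i \<in> A)"

definition tuple_dot ::
    "nat \<Rightarrow> (nat \<Rightarrow> 'a \<Rightarrow> complex) \<Rightarrow> (nat \<Rightarrow> 'a \<Rightarrow> complex) \<Rightarrow> 'a \<Rightarrow> complex" where
  "tuple_dot n H K w = (\<Sum>i<n. H i w * K i w)"

definition tuple_norm :: "nat \<Rightarrow> (nat \<Rightarrow> 'a \<Rightarrow> complex) \<Rightarrow> 'a \<Rightarrow> real" where
  "tuple_norm n H w = L2_set (\<lambda>i. cmod (H i w)) {..<n}"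

definition M_set :: "'a topology \<Rightarrow> ('a \<Rightarrow> complex) set \<Rightarrow> ('a \<Rightarrow> real) set" where
  "M_set X A =
     {f. strictly_positive X f \<and>
         (\<exists>(m :: nat \<Rightarrow> nat) H K.
            (\<forall>n. is_tuple A (m n) (H n) \<and> is_tuple A (m n) (K n) \<and>
                 (\<forall>w\<in>topspace X. tuple_dot (m n) (H n) (K n) w = 1)) \<and>
            uniform_limit (topspace X) (\<lambda>n. tuple_norm (m n) (K n)) f sequentially \<and>
            uniform_limit (topspace X) (\<lambda>n. tuple_norm (m n) (H n)) (\<lambda>w. inverse (f w)) sequentially)}"

definition bimod :: "'a topology \<Rightarrow> ('a \<Rightarrow> complex) set \<Rightarrow> ('a \<Rightarrow> real) \<Rightarrow> ('a \<Rightarrow> complex) set" where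
  "bimod X A f = {x. \<exists>a\<in>A. \<forall>w\<in>topspace X. x w = a w * complex_of_real (f w)}"

definition morita_cond ::
    "'a topology \<Rightarrow> ('a \<Rightarrow> complex) set \<Rightarrow> ('a \<Rightarrow> real) \<Rightarrow> real \<Rightarrow> nat \<Rightarrow> bool" where
  "morita_cond X A f \<epsilon> n \<longleftrightarrow>
     (\<exists>x y. (\<forall>i<n. x i \<in> bimod X A f \<and> y i \<in> bimod X A (\<lambda>w. inverse (f w))) \<and>
            (\<forall>w\<in>topspace X. (\<Sum>i<n. x i w * y i w) = 1 \<and>
               (\<Sum>i<n. (cmod (x i w))\<^sup>2) \<le> 1 + \<epsilon> \<and>
               (\<Sum>i<n. (cmod (y i w))\<^sup>2) \<le> 1 + \<epsilon>))"

definition strong_morita_bimodule ::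
    "'a topology \<Rightarrow> ('a \<Rightarrow> complex) set \<Rightarrow> ('a \<Rightarrow> real) \<Rightarrow> bool" where
  "strong_morita_bimodule X A f \<longleftrightarrow> (\<forall>\<epsilon>>0. \<exists>n. morita_cond X A f \<epsilon> n)"

definition rank1_strong_morita_bimodule ::
    "'a topology \<Rightarrow> ('a \<Rightarrow> complex) set \<Rightarrow> ('a \<Rightarrow> real) \<Rightarrow> bool" where
  "rank1_strong_morita_bimodule X A f \<longleftrightarrow> (\<forall>\<epsilon>>0. morita_cond X A f \<epsilon> 1)"

text \<open>The same number \<open>n\<close> of elements \<open>x i\<close> and \<open>y i\<close> is no restriction, since either family may
  be padded with zeros.\<close>

definition subequivalence_cond ::
    "'a topology \<Rightarrow> ('a \<Rightarrow> complex) set \<Rightarrow> ('a \<Rightarrow> real) \<Rightarrow> real \<Rightarrow> nat \<Rightarrow> bool" where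
  "subequivalence_cond X A f \<epsilon> n \<longleftrightarrow>
     (\<exists>x y. (\<forall>i<n. x i \<in> bimod X A f \<and> y i \<in> bimod X A (\<lambda>w. inverse (f w))) \<and>
            (\<forall>w\<in>topspace X.
               1 - \<epsilon> \<le> (\<Sum>i<n. (cmod (x i w))\<^sup>2) \<and> (\<Sum>i<n. (cmod (x i w))\<^sup>2) \<le> 1 + \<epsilon> \<and>
               1 - \<epsilon> \<le> (\<Sum>i<n. (cmod (y i w))\<^sup>2) \<and> (\<Sum>i<n. (cmod (y i w))\<^sup>2) \<le> 1 + \<epsilon>))"

definition strong_subequivalence_bimodule ::
    "'a topology \<Rightarrow> ('a \<Rightarrow> complex) set \<Rightarrow> ('a \<Rightarrow> real) \<Rightarrow> bool" where
  "strong_subequivalence_bimodule X A f \<longleftrightarrow> (\<forall>\<epsilon>>0. \<exists>n. subequivalence_cond X A f \<epsilon> n)"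

definition unitary_subequivalence_bimodule ::
    "'a topology \<Rightarrow> ('a \<Rightarrow> complex) set \<Rightarrow> ('a \<Rightarrow> real) \<Rightarrow> bool" where
  "unitary_subequivalence_bimodule X A f \<longleftrightarrow> subequivalence_cond X A f 0 1"

end

theory Submission
  imports Defs
begin

text \<open>
  Writing \<open>x\<^sub>i = h\<^sub>i f\<close> and \<open>y\<^sub>i = k\<^sub>i / f\<close> with \<open>h\<^sub>i, k\<^sub>i \<in> A\<close> turns every condition on
  the bimodules into one on \<open>A\<close>-tuples \<open>H\<close>, \<open>K\<close>, and since \<open>f\<close> and \<open>1 / f\<close> are
  bounded by compactness, errors relative to \<open>f\<close> may be exchanged for absolute ones. In the Morita
  conditions only upper bounds are given; the lower bounds come from Cauchy--Schwarz,
  \<open>1 = \<bar>H \<cdot> K\<bar> \<le> \<parallel>H\<parallel> \<parallel>K\<parallel>\<close>.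
\<close>

section \<open>Euclidean norms of tuples and coefficients of bimodule elements\<close>

lemma tuple_norm_nonneg: "0 \<le> tuple_norm n H w"
  by (simp add: tuple_norm_def)

lemma tuple_norm_power2: "(tuple_norm n H w)\<^sup>2 = (\<Sum>i<n. (cmod (H i w))\<^sup>2)"
  by (simp add: tuple_norm_def L2_set_def sum_nonneg)

lemma tuple_norm_1: "tuple_norm 1 H w = cmod (H 0 w)"
  by (simp add: tuple_norm_def L2_set_def)

lemma tuple_dot_1: "tuple_dot 1 H K w = H 0 w * K 0 w"
  by (simp add: tuple_dot_def)

lemma is_tuple_1: "is_tuple A 1 H \<longleftrightarrow> H 0 \<in> A"
  by (simp add: is_tuple_def)

text \<open>Cauchy--Schwarz for the moduli, after the triangle inequality. The product
  \<open>tuple_dot\<close> carries no complex conjugation, which makes no difference once moduli are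
  taken.\<close>

lemma norm_tuple_dot_le: "cmod (tuple_dot n H K w) \<le> tuple_norm n H w * tuple_norm n K w"
proof -
  have "cmod (tuple_dot n H K w) \<le> (\<Sum>i<n. \<bar>cmod (H i w)\<bar> * \<bar>cmod (K i w)\<bar>)"
    unfolding tuple_dot_def by (rule order_trans[OF norm_sum]) (simp add: norm_mult)
  also have "\<dots> \<le> tuple_norm n H w * tuple_norm n K w"
    unfolding tuple_norm_def by (rule L2_set_mult_ineq)
  finally show ?thesis .
qed

text \<open>Stated at a single point with a number \<open>c\<close>, so that it serves both
  \<open>c = f w\<close> and \<open>c = inverse (f w)\<close>.\<close>

lemma tuple_norm_mult_right:
  assumes "0 \<le> c" and "\<And>i. i < n \<Longrightarrow> x i w = H i w * complex_of_real c"
  shows "(\<Sum>i<n. (cmod (x i w))\<^sup>2) = (tuple_norm n H w * c)\<^sup>2"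
proof -
  have "(\<Sum>i<n. (cmod (x i w))\<^sup>2) = (\<Sum>i<n. (cmod (H i w))\<^sup>2 * c\<^sup>2)"
    by (rule sum.cong) (use assms in \<open>auto simp: norm_mult power_mult_distrib\<close>)
  then show ?thesis
    by (simp add: power_mult_distrib tuple_norm_power2 sum_distrib_right)
qed

lemma bimod_tupleE:
  assumes "\<forall>i<n. x i \<in> bimod X A f"
  obtains H where "is_tuple A n H"
    and "\<And>i w. i < n \<Longrightarrow> w \<in> topspace X \<Longrightarrow> x i w = H i w * complex_of_real (f w)"
proof -
  \<comment> \<open>The bound on \<open>i\<close> stands inside the existential, so that choice
    gives a family \<open>H\<close> on all indices, constrained only below \<open>n\<close>.\<close>
  from assms have "\<forall>i. \<exists>a. i < n \<longrightarrow> a \<in> A \<and> (\<forall>w\<in>topspace X. x i w = a w * complex_of_real (f w))"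
    unfolding bimod_def by blast
  then obtain H where "\<forall>i. i < n \<longrightarrow> H i \<in> A \<and> (\<forall>w\<in>topspace X. x i w = H i w * complex_of_real (f w))"
    by metis
  then show thesis
    by (intro that[of H]) (auto simp: is_tuple_def)
qed

lemma tuple_mult_in_bimod:
  "is_tuple A n H \<Longrightarrow> i < n \<Longrightarrow> (\<lambda>w. H i w * complex_of_real (f w)) \<in> bimod X A f"
  unfolding is_tuple_def bimod_def by auto

section \<open>The Morita conditions in terms of tuples\<close>

text \<open>With the slack written as \<open>s\<^sup>2 - 1\<close>, the bounds on the sums of
  squares become squares bounded by \<open>s\<^sup>2\<close>, and roots can be taken on both sides.
  The product condition loses \<open>f\<close> altogether, since the factors \<open>f\<close> and
  \<open>1 / f\<close> cancel.\<close>

lemma morita_cond_iff: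
  assumes "strictly_positive X f" and "0 \<le> s"
  shows "morita_cond X A f (s\<^sup>2 - 1) n \<longleftrightarrow>
    (\<exists>H K. is_tuple A n H \<and> is_tuple A n K \<and>
       (\<forall>w\<in>topspace X. tuple_dot n H K w = 1 \<and>
          tuple_norm n H w * f w \<le> s \<and> tuple_norm n K w * inverse (f w) \<le> s))"
    (is "?L \<longleftrightarrow> ?R")
proof
  have pos: "0 < f w" if "w \<in> topspace X" for w
    using assms(1) that by (simp add: strictly_positive_def)
  {
    assume ?L
    then obtain x y where x: "\<forall>i<n. x i \<in> bimod X A f"
      and y: "\<forall>i<n. y i \<in> bimod X A (\<lambda>w. inverse (f w))"
      and xy: "\<forall>w\<in>topspace X. (\<Sum>i<n. x i w * y i w) = 1 \<and>
        (\<Sum>i<n. (cmod (x i w))\<^sup>2) \<le> s\<^sup>2 \<and> (\<Sum>i<n. (cmod (y i w))\<^sup>2) \<le> s\<^sup>2"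
      unfolding morita_cond_def by auto
    obtain H where H: "is_tuple A n H"
      "\<And>i w. i < n \<Longrightarrow> w \<in> topspace X \<Longrightarrow> x i w = H i w * complex_of_real (f w)"
      using bimod_tupleE[OF x] by blast
    obtain K where K: "is_tuple A n K"
      "\<And>i w. i < n \<Longrightarrow> w \<in> topspace X \<Longrightarrow> y i w = K i w * complex_of_real (inverse (f w))"
      using bimod_tupleE[OF y] by blast
    show ?R
    proof (intro exI conjI ballI)
      fix w assume w: "w \<in> topspace X"
      note fw = pos[OF w]
      have "x i w * y i w = H i w * K i w" if "i < n" for i
        using H(2)[OF that w] K(2)[OF that w] fw by simp
      then have "tuple_dot n H K w = (\<Sum>i<n. x i w * y i w)"
        unfolding tuple_dot_def by (intro sum.cong) auto
      then show "tuple_dot n H K w = 1"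
        using xy w by simp
      have "(\<Sum>i<n. (cmod (x i w))\<^sup>2) = (tuple_norm n H w * f w)\<^sup>2"
        using fw H(2)[OF _ w] by (intro tuple_norm_mult_right) auto
      then have "(tuple_norm n H w * f w)\<^sup>2 \<le> s\<^sup>2"
        using xy w by metis
      then show "tuple_norm n H w * f w \<le> s"
        using assms(2) by (rule power2_le_imp_le)
      have "(\<Sum>i<n. (cmod (y i w))\<^sup>2) = (tuple_norm n K w * inverse (f w))\<^sup>2"
        using fw K(2)[OF _ w] by (intro tuple_norm_mult_right) auto
      then have "(tuple_norm n K w * inverse (f w))\<^sup>2 \<le> s\<^sup>2"
        using xy w by metis
      then show "tuple_norm n K w * inverse (f w) \<le> s"
        using assms(2) by (rule power2_le_imp_le)
    qed (fact H(1) K(1))+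
  next
    assume ?R
    then obtain H K where H: "is_tuple A n H" and K: "is_tuple A n K"
      and HK: "\<forall>w\<in>topspace X. tuple_dot n H K w = 1 \<and>
          tuple_norm n H w * f w \<le> s \<and> tuple_norm n K w * inverse (f w) \<le> s"
      by blast
    define x where "x i w = H i w * complex_of_real (f w)" for i w
    define y where "y i w = K i w * complex_of_real (inverse (f w))" for i w
    have "x i \<in> bimod X A f \<and> y i \<in> bimod X A (\<lambda>w. inverse (f w))" if "i < n" for i
      unfolding x_def y_def by (intro conjI tuple_mult_in_bimod[of A n] H K that)
    moreover have "(\<Sum>i<n. x i w * y i w) = 1 \<and>
        (\<Sum>i<n. (cmod (x i w))\<^sup>2) \<le> s\<^sup>2 \<and> (\<Sum>i<n. (cmod (y i w))\<^sup>2) \<le> s\<^sup>2"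
      if w: "w \<in> topspace X" for w
    proof (intro conjI)
      note fw = pos[OF w]
      have "x i w * y i w = H i w * K i w" for i
        using fw by (simp add: x_def y_def)
      then show "(\<Sum>i<n. x i w * y i w) = 1"
        using HK w by (simp add: tuple_dot_def)
      show "(\<Sum>i<n. (cmod (x i w))\<^sup>2) \<le> s\<^sup>2"
        using tuple_norm_mult_right[of "f w" n x w H] fw HK w
        by (simp add: x_def power_mono tuple_norm_nonneg)
      show "(\<Sum>i<n. (cmod (y i w))\<^sup>2) \<le> s\<^sup>2"
        using tuple_norm_mult_right[of "inverse (f w)" n y w K] fw HK w
        by (simp add: y_def power_mono tuple_norm_nonneg)
    qed
    ultimately show ?L
      unfolding morita_cond_def by auto
  }
qed

section \<open>Tuples with product 1 and norms near \<open>f\<close> and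
  \<open>1 / f\<close>\<close>

text \<open>This is the meeting point of both Morita equivalences: \<open>M_set\<close> asks for it
  with some length \<open>n\<close> for each error, \<open>Q_closure_pos\<close> with
  \<open>n = 1\<close>. The tuple \<open>H\<close>, whose entries multiply \<open>f\<close> in the
  bimodule, is the one with norm near \<open>1 / f\<close>.\<close>

definition near_inverse_pair ::
    "'a topology \<Rightarrow> ('a \<Rightarrow> complex) set \<Rightarrow> ('a \<Rightarrow> real) \<Rightarrow> real \<Rightarrow> nat \<Rightarrow> bool" where
  "near_inverse_pair X A f e n \<longleftrightarrow>
     (\<exists>H K. is_tuple A n H \<and> is_tuple A n K \<and>
        (\<forall>w\<in>topspace X. tuple_dot n H K w = 1 \<and>
           \<bar>tuple_norm n K w - f w\<bar> < e \<and> \<bar>tuple_norm n H w - inverse (f w)\<bar> < e))"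

text \<open>Used with \<open>a\<close> and \<open>b\<close> the norms of the two tuples, in either
  order. The bound on \<open>a\<close> gives \<open>a \<le> s * c\<close>, while
  \<open>c \<le> a * (b * c) \<le> a * s\<close> gives \<open>c / s \<le> a\<close>. So
  \<open>a / c\<close> lies between \<open>1 / s\<close> and \<open>s\<close>.\<close>

lemma abs_diff_le_of_ratio:
  fixes a b c s :: real
  assumes "0 < c" "0 \<le> a" "0 < s" "a * inverse c \<le> s" "b * c \<le> s" "1 \<le> a * b"
  shows "\<bar>a - c\<bar> \<le> c * (s - 1)"
proof -
  have 1: "a \<le> s * c"
    using assms by (simp add: field_simps)
  have "c \<le> a * b * c"
    using assms by simp
  also have "\<dots> \<le> a * s"
    using mult_left_mono[OF assms(5,2)] by (simp add: mult.assoc)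
  finally have "c / s \<le> a"
    using assms by (simp add: field_simps)
  \<comment> \<open>The tangent of \<open>1 / s\<close> at \<open>s = 1\<close> lies below the
    graph. This makes the lower error no larger than the upper one,
    \<open>c * (s - 1)\<close>.\<close>
  moreover have "2 - s \<le> 1 / s"
  proof -
    have "(2 - s) * s \<le> 1"
      using zero_le_power2[of "s - 1"] by (simp add: power2_eq_square algebra_simps)
    then show ?thesis
      using assms by (simp add: field_simps)
  qed
  then have "c * (2 - s) \<le> c / s"
    using mult_left_mono[of "2 - s" "1 / s" c] assms by simp
  ultimately show ?thesis
    using 1 by (simp add: algebra_simps abs_le_iff)
qed

lemma near_inverse_pair_of_morita_cond:
  assumes "strictly_positive X f" and "0 < e" and "1 \<le> C"
    and C: "\<And>w. w \<in> topspace X \<Longrightarrow> f w \<le> C \<and> inverse (f w) \<le> C"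
    and M: "morita_cond X A f ((1 + e / (2 * C))\<^sup>2 - 1) n"
  shows "near_inverse_pair X A f e n"
proof -
  \<comment> \<open>A relative error \<open>s - 1\<close> costs an absolute error of at most
    \<open>C * (s - 1) = e / 2\<close>; the halving yields the strict inequality.\<close>
  define s where "s = 1 + e / (2 * C)"
  have s: "1 < s"
    using assms by (simp add: s_def)
  have Cs: "c * (s - 1) < e" if "c \<le> C" for c
  proof -
    have "c * (s - 1) \<le> C * (s - 1)"
      using that s by (intro mult_right_mono) auto
    also have "\<dots> < e"
      using assms by (simp add: s_def)
    finally show ?thesis .
  qed
  obtain H K where H: "is_tuple A n H" and K: "is_tuple A n K"
    and HK: "\<forall>w\<in>topspace X. tuple_dot n H K w = 1 \<and>
          tuple_norm n H w * f w \<le> s \<and> tuple_norm n K w * inverse (f w) \<le> s"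
    using M morita_cond_iff[OF assms(1), of s A n] s unfolding s_def by auto
  show ?thesis
    unfolding near_inverse_pair_def
  proof (intro exI conjI ballI)
    fix w assume w: "w \<in> topspace X"
    have fw: "0 < f w"
      using assms(1) w by (simp add: strictly_positive_def)
    show "tuple_dot n H K w = 1"
      using HK w by simp
    have 1: "1 \<le> tuple_norm n H w * tuple_norm n K w"
      using norm_tuple_dot_le[of n H K w] HK w by simp
    have "\<bar>tuple_norm n K w - f w\<bar> \<le> f w * (s - 1)"
      using HK w fw s 1
      by (intro abs_diff_le_of_ratio[where b = "tuple_norm n H w"])
        (auto simp: tuple_norm_nonneg mult.commute)
    then show "\<bar>tuple_norm n K w - f w\<bar> < e"
      using Cs[of "f w"] C[OF w] by linarith
    \<comment> \<open>The same estimate with \<open>H\<close> and \<open>K\<close> exchanged and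
      \<open>f\<close> replaced by \<open>1 / f\<close>.\<close>
    have "\<bar>tuple_norm n H w - inverse (f w)\<bar> \<le> inverse (f w) * (s - 1)"
      using HK w fw s 1
      by (intro abs_diff_le_of_ratio[where b = "tuple_norm n K w"])
        (auto simp: tuple_norm_nonneg)
    then show "\<bar>tuple_norm n H w - inverse (f w)\<bar> < e"
      using Cs[of "inverse (f w)"] C[OF w] by linarith
  qed (fact H K)+
qed

lemma morita_cond_of_near_inverse_pair:
  assumes "strictly_positive X f" and "0 < \<epsilon>" and "1 \<le> C"
    and C: "\<And>w. w \<in> topspace X \<Longrightarrow> f w \<le> C \<and> inverse (f w) \<le> C"
    and M: "near_inverse_pair X A f ((sqrt (1 + \<epsilon>) - 1) / C) n"
  shows "morita_cond X A f \<epsilon> n"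
proof -
  define s where "s = sqrt (1 + \<epsilon>)"
  have s: "1 < s" "s\<^sup>2 - 1 = \<epsilon>"
    using assms by (auto simp: s_def)
  \<comment> \<open>Here \<open>d\<close> is the signed error of a norm whose target is
    \<open>inverse c\<close>, so it may be negative. The tolerance \<open>(s - 1) / C\<close> is
    chosen so that \<open>d * c \<le> s - 1\<close> whenever \<open>c \<le> C\<close>.\<close>
  have Cs: "(inverse c + d) * c \<le> s" if "0 < c" "c \<le> C" "d < (s - 1) / C" for c d
  proof -
    have "d * c \<le> (s - 1) / C * C"
      by (rule mult_mono) (use that s assms in auto)
    moreover have "(inverse c + d) * c = 1 + d * c"
      using that by (simp add: distrib_right)
    ultimately show ?thesis
      using assms(3) by simp
  qed
  obtain H K where H: "is_tuple A n H" and K: "is_tuple A n K"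
    and HK: "\<forall>w\<in>topspace X. tuple_dot n H K w = 1 \<and> \<bar>tuple_norm n K w - f w\<bar> < (s - 1) / C \<and>
       \<bar>tuple_norm n H w - inverse (f w)\<bar> < (s - 1) / C"
    using M unfolding near_inverse_pair_def s_def by auto
  have "tuple_norm n H w * f w \<le> s \<and> tuple_norm n K w * inverse (f w) \<le> s"
    if w: "w \<in> topspace X" for w
  proof
    have fw: "0 < f w"
      using assms(1) w by (simp add: strictly_positive_def)
    show "tuple_norm n H w * f w \<le> s"
      using Cs[of "f w" "tuple_norm n H w - inverse (f w)"] fw C[OF w] HK w by auto
    show "tuple_norm n K w * inverse (f w) \<le> s"
      using Cs[of "inverse (f w)" "tuple_norm n K w - f w"] fw C[OF w] HK w by auto
  qed
  then have "morita_cond X A f (s\<^sup>2 - 1) n"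
    using morita_cond_iff[OF assms(1), of s A n] s H K HK by auto
  then show ?thesis
    by (simp add: s)
qed

section \<open>Bounds from compactness\<close>

lemma continuous_map_real_inverse_pos:
  assumes "continuous_map X euclideanreal f" and "strictly_positive X f"
  shows "continuous_map X euclideanreal (\<lambda>w. inverse (f w))"
  using assms by (intro continuous_map_real_inverse) (auto simp: strictly_positive_def)

lemma compact_space_real_bounded_above:
  assumes "compact_space X" and "continuous_map X euclideanreal f"
  obtains C where "\<And>w. w \<in> topspace X \<Longrightarrow> f w \<le> C"
proof -
  have "compact (f ` topspace X)"
    using image_compactin[of X "topspace X" euclideanreal f] assms
    by (simp add: compact_space_def)
  then have "bounded (f ` topspace X)"
    by (rule compact_imp_bounded)
  then obtain B where "\<forall>w\<in>topspace X. \<bar>f w\<bar> \<le> B"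
    by (auto simp: bounded_iff)
  then show thesis
    by (intro that[of B]) force
qed

lemma compact_space_two_sided_bound:
  assumes "compact_space X" and "continuous_map X euclideanreal f" and "strictly_positive X f"
  obtains C where "1 \<le> C" and "\<And>w. w \<in> topspace X \<Longrightarrow> f w \<le> C \<and> inverse (f w) \<le> C"
proof -
  obtain B where B: "\<And>w. w \<in> topspace X \<Longrightarrow> f w \<le> B"
    using compact_space_real_bounded_above[OF assms(1,2)] by blast
  obtain D where D: "\<And>w. w \<in> topspace X \<Longrightarrow> inverse (f w) \<le> D"
    using compact_space_real_bounded_above[OF assms(1) continuous_map_real_inverse_pos[OF assms(2,3)]]
    by blast
  \<comment> \<open>On a nonempty space the bounds on \<open>f\<close> and \<open>1 / f\<close>
    already force \<open>1 \<le> C\<close>; the maximum with 1 covers the empty space.\<close>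
  show thesis
    by (rule that[of "max 1 (max B D)"]) (use B D in \<open>force simp: le_max_iff_disj\<close>)+
qed

text \<open>The set \<open>N\<close> of allowed lengths lets one statement serve rank 1 and
  arbitrary rank. Both conversions keep \<open>n\<close> and turn each positive tolerance into a
  positive one, so the quantifiers transfer.\<close>

lemma all_morita_cond_iff_near_inverse_pair:
  assumes "compact_space X" and "continuous_map X euclideanreal f" and "strictly_positive X f"
  shows "(\<forall>\<epsilon>>0. \<exists>n\<in>N. morita_cond X A f \<epsilon> n) \<longleftrightarrow> (\<forall>e>0. \<exists>n\<in>N. near_inverse_pair X A f e n)"
proof -
  obtain C where C: "1 \<le> C" "\<And>w. w \<in> topspace X \<Longrightarrow> f w \<le> C \<and> inverse (f w) \<le> C"
    using compact_space_two_sided_bound[OF assms] by blast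
  have 1: "0 < (1 + e / (2 * C))\<^sup>2 - 1" if "0 < e" for e
    using that C(1) by (simp add: power2_eq_square algebra_simps add_pos_pos)
  have 2: "0 < (sqrt (1 + \<epsilon>) - 1) / C" if "0 < \<epsilon>" for \<epsilon>
    using that C(1) by simp
  show ?thesis
  proof (intro iffI allI impI)
    fix e :: real assume M: "\<forall>\<epsilon>>0. \<exists>n\<in>N. morita_cond X A f \<epsilon> n" and e: "0 < e"
    obtain n where "n \<in> N" "morita_cond X A f ((1 + e / (2 * C))\<^sup>2 - 1) n"
      using M 1[OF e] by blast
    then show "\<exists>n\<in>N. near_inverse_pair X A f e n"
      using near_inverse_pair_of_morita_cond[OF assms(3) e C] by blast
  next
    fix \<epsilon> :: real assume M: "\<forall>e>0. \<exists>n\<in>N. near_inverse_pair X A f e n" and \<epsilon>: "0 < \<epsilon>"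
    obtain n where "n \<in> N" "near_inverse_pair X A f ((sqrt (1 + \<epsilon>) - 1) / C) n"
      using M 2[OF \<epsilon>] by blast
    then show "\<exists>n\<in>N. morita_cond X A f \<epsilon> n"
      using morita_cond_of_near_inverse_pair[OF assms(3) \<epsilon> C] by blast
  qed
qed

section \<open>Uniform limits of norms of tuples\<close>

text \<open>Forwards, one index is taken late enough for both uniform limits. Backwards, pairs are
  chosen with error \<open>1 / (k + 1)\<close> for each \<open>k\<close>, and these form the
  required sequences.\<close>

lemma M_set_iff_near_inverse_pair:
  assumes "strictly_positive X f"
  shows "f \<in> M_set X A \<longleftrightarrow> (\<forall>e>0. \<exists>n. near_inverse_pair X A f e n)"
proof
  assume "f \<in> M_set X A"
  then obtain m H K where HK: "\<forall>n. is_tuple A (m n) (H n) \<and> is_tuple A (m n) (K n) \<and>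
                 (\<forall>w\<in>topspace X. tuple_dot (m n) (H n) (K n) w = 1)"
    and lim: "uniform_limit (topspace X) (\<lambda>n. tuple_norm (m n) (K n)) f sequentially"
      "uniform_limit (topspace X) (\<lambda>n. tuple_norm (m n) (H n)) (\<lambda>w. inverse (f w)) sequentially"
    unfolding M_set_def by blast
  show "\<forall>e>0. \<exists>n. near_inverse_pair X A f e n"
  proof (intro allI impI)
    fix e :: real assume e: "0 < e"
    have "\<forall>\<^sub>F n in sequentially.
        (\<forall>w\<in>topspace X. dist (tuple_norm (m n) (K n) w) (f w) < e) \<and>
        (\<forall>w\<in>topspace X. dist (tuple_norm (m n) (H n) w) (inverse (f w)) < e)"
      using uniform_limitD[OF lim(1) e] uniform_limitD[OF lim(2) e] by (rule eventually_conj)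
    then obtain n where
        "\<forall>w\<in>topspace X. dist (tuple_norm (m n) (K n) w) (f w) < e"
        "\<forall>w\<in>topspace X. dist (tuple_norm (m n) (H n) w) (inverse (f w)) < e"
      by (auto simp: eventually_sequentially)
    then have "near_inverse_pair X A f e (m n)"
      unfolding near_inverse_pair_def dist_real_def using HK by blast
    then show "\<exists>n. near_inverse_pair X A f e n" ..
  qed
next
  assume "\<forall>e>0. \<exists>n. near_inverse_pair X A f e n"
  then have "\<forall>k. \<exists>n H K. is_tuple A n H \<and> is_tuple A n K \<and>
        (\<forall>w\<in>topspace X. tuple_dot n H K w = 1 \<and>
           \<bar>tuple_norm n K w - f w\<bar> < inverse (real (Suc k)) \<and>
           \<bar>tuple_norm n H w - inverse (f w)\<bar> < inverse (real (Suc k)))"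
    unfolding near_inverse_pair_def by auto
  then obtain m H K where HK: "\<And>k. is_tuple A (m k) (H k) \<and> is_tuple A (m k) (K k) \<and>
        (\<forall>w\<in>topspace X. tuple_dot (m k) (H k) (K k) w = 1 \<and>
           \<bar>tuple_norm (m k) (K k) w - f w\<bar> < inverse (real (Suc k)) \<and>
           \<bar>tuple_norm (m k) (H k) w - inverse (f w)\<bar> < inverse (real (Suc k)))"
    by metis
  have small: "\<forall>\<^sub>F k in sequentially. inverse (real (Suc k)) < e" if "0 < e" for e
    using LIMSEQ_inverse_real_of_nat that by (rule order_tendstoD)
  have "uniform_limit (topspace X) (\<lambda>k. tuple_norm (m k) (K k)) f sequentially"
  proof (rule uniform_limitI)
    fix e :: real assume "0 < e"
    show "\<forall>\<^sub>F k in sequentially. \<forall>w\<in>topspace X. dist (tuple_norm (m k) (K k) w) (f w) < e"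
      using small[OF \<open>0 < e\<close>]
      by eventually_elim (use HK in \<open>force simp: dist_real_def intro: less_trans\<close>)
  qed
  moreover have "uniform_limit (topspace X) (\<lambda>k. tuple_norm (m k) (H k)) (\<lambda>w. inverse (f w)) sequentially"
  proof (rule uniform_limitI)
    fix e :: real assume "0 < e"
    show "\<forall>\<^sub>F k in sequentially. \<forall>w\<in>topspace X. dist (tuple_norm (m k) (H k) w) (inverse (f w)) < e"
      using small[OF \<open>0 < e\<close>]
      by eventually_elim (use HK in \<open>force simp: dist_real_def intro: less_trans\<close>)
  qed
  ultimately show "f \<in> M_set X A"
    unfolding M_set_def using assms HK by blast
qed

section \<open>Moduli of invertible elements\<close>

text \<open>Since \<open>1 / C \<le> c\<close>, the first entry of the minimum keeps
  \<open>a\<close> above \<open>1 / (2 * C)\<close>. Then \<open>\<bar>a - c\<bar> / (a * c)\<close>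
  is at most \<open>2 * C\<^sup>2 * \<bar>a - c\<bar>\<close>, which the second entry makes smaller
  than \<open>e\<close>.\<close>

lemma abs_inverse_diff_less:
  fixes a c C d e :: real
  assumes "0 < c" "1 \<le> C" "inverse c \<le> C" "0 < e"
    and d: "d = min (1 / (2 * C)) (e / (2 * C\<^sup>2))" and a: "\<bar>a - c\<bar> < d"
  shows "\<bar>inverse a - inverse c\<bar> < e"
proof -
  have c: "1 / C \<le> c"
    using assms by (simp add: field_simps)
  have "d \<le> 1 / (2 * C)"
    using d by simp
  moreover have "1 / (2 * C) = 1 / C / 2"
    by simp
  ultimately have a_ge: "1 / (2 * C) \<le> a"
    using c a by linarith
  then have a0: "0 < a"
    using \<open>1 \<le> C\<close> by (smt (verit) divide_pos_pos)
  have "inverse a \<le> 2 * C"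
    using a_ge a0 \<open>1 \<le> C\<close> by (simp add: field_simps)
  then have "inverse a * inverse c \<le> 2 * C * C"
    using assms a0 by (intro mult_mono) auto
  moreover have "\<bar>inverse a - inverse c\<bar> = \<bar>a - c\<bar> * (inverse a * inverse c)"
    using a0 assms(1) by (simp add: inverse_diff_inverse abs_mult mult.commute mult.left_commute abs_minus_commute)
  ultimately have "\<bar>inverse a - inverse c\<bar> \<le> \<bar>a - c\<bar> * (2 * C * C)"
    by (simp add: mult_left_mono)
  also have "\<dots> < e / (2 * C\<^sup>2) * (2 * C * C)"
    using a d \<open>1 \<le> C\<close> by (intro mult_strict_right_mono) auto
  also have "\<dots> = e"
    using \<open>1 \<le> C\<close> by (simp add: power2_eq_square)
  finally show ?thesis .
qed

text \<open>For length 1, \<open>H \<cdot> K = 1\<close> says that \<open>K 0\<close> is a unit with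
  inverse \<open>H 0\<close>. Closeness of \<open>\<bar>g\<bar>\<close> to \<open>f\<close> passes
  to the inverses because \<open>f\<close> is bounded away from 0.\<close>

lemma Q_closure_pos_iff_near_inverse_pair:
  assumes "compact_space X" and "continuous_map X euclideanreal f" and "strictly_positive X f"
  shows "f \<in> Q_closure_pos X A \<longleftrightarrow> (\<forall>e>0. near_inverse_pair X A f e 1)"
proof
  assume f: "f \<in> Q_closure_pos X A"
  obtain C where C: "1 \<le> C" "\<And>w. w \<in> topspace X \<Longrightarrow> f w \<le> C \<and> inverse (f w) \<le> C"
    using compact_space_two_sided_bound[OF assms] by blast
  show "\<forall>e>0. near_inverse_pair X A f e 1"
  proof (intro allI impI)
    fix e :: real assume e: "0 < e"
    define d where "d = min (1 / (2 * C)) (e / (2 * C\<^sup>2))"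
    \<comment> \<open>The tolerance \<open>d\<close> controls the inverse of \<open>g\<close>, and
      \<open>e\<close> controls \<open>g\<close> itself.\<close>
    have "0 < min d e"
      using C(1) e by (simp add: d_def)
    then obtain q where "q \<in> Q_set X A" and q: "\<forall>w\<in>topspace X. dist (q w) (f w) < min d e"
      using f unfolding Q_closure_pos_def uniform_closure_def by blast
    then obtain g h where gh: "g \<in> A" "h \<in> A" "\<forall>w\<in>topspace X. g w * h w = 1"
      and qg: "\<forall>w\<in>topspace X. q w = cmod (g w)"
      unfolding Q_set_def alg_units_def by blast
    have "\<bar>cmod (g w) - f w\<bar> < e \<and> \<bar>cmod (h w) - inverse (f w)\<bar> < e" if w: "w \<in> topspace X" for w
    proof
      have gf: "\<bar>cmod (g w) - f w\<bar> < min d e"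
        using q qg w by (simp add: dist_real_def)
      then show "\<bar>cmod (g w) - f w\<bar> < e"
        by simp
      have "h w = inverse (g w)"
        using gh w by (metis inverse_unique)
      moreover have "\<bar>inverse (cmod (g w)) - inverse (f w)\<bar> < e"
        by (rule abs_inverse_diff_less[OF _ C(1) _ e d_def])
          (use gf C w assms(3) in \<open>auto simp: strictly_positive_def\<close>)
      ultimately show "\<bar>cmod (h w) - inverse (f w)\<bar> < e"
        by (simp add: norm_inverse)
    qed
    then show "near_inverse_pair X A f e 1"
      unfolding near_inverse_pair_def tuple_norm_1 tuple_dot_1 is_tuple_1
      using gh by (intro exI[of _ "\<lambda>_. h"] exI[of _ "\<lambda>_. g"]) (auto simp: mult.commute)
  qed
next
  assume R: "\<forall>e>0. near_inverse_pair X A f e 1"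
  have "\<exists>q\<in>Q_set X A. \<forall>w\<in>topspace X. dist (q w) (f w) < e" if e: "0 < e" for e
  proof -
    obtain H K where "is_tuple A 1 H" "is_tuple A 1 K"
      "\<forall>w\<in>topspace X. tuple_dot 1 H K w = 1 \<and> \<bar>tuple_norm 1 K w - f w\<bar> < e"
      using R e unfolding near_inverse_pair_def by blast
    then have HK: "H 0 \<in> A" "K 0 \<in> A"
      "\<forall>w\<in>topspace X. H 0 w * K 0 w = 1 \<and> \<bar>cmod (K 0 w) - f w\<bar> < e"
      unfolding tuple_norm_1 tuple_dot_1 is_tuple_1 by blast+
    \<comment> \<open>The unit approximating \<open>f\<close> is \<open>K 0\<close>, with
      \<open>H 0\<close> as its inverse in \<open>A\<close>.\<close>
    have "K 0 \<in> alg_units X A"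
      using HK unfolding alg_units_def by (auto simp: mult.commute)
    then have "(\<lambda>w. cmod (K 0 w)) \<in> Q_set X A"
      unfolding Q_set_def by auto
    then show ?thesis
      using HK by (intro bexI[of _ "\<lambda>w. cmod (K 0 w)"]) (auto simp: dist_real_def)
  qed
  then show "f \<in> Q_closure_pos X A"
    using assms unfolding Q_closure_pos_def uniform_closure_def by blast
qed

section \<open>Uniform closure of the sums of squares\<close>

text \<open>Dividing the error by \<open>p\<close>, which is bounded above and away from 0, turns
  uniform approximation into approximation of the quotient to 1. This relative form is the one in
  which the subequivalence condition appears.\<close>

lemma G_set_iff:
  assumes "compact_space X" and "continuous_map X euclideanreal p" and "strictly_positive X p"
  shows "p \<in> G_set X A \<longleftrightarrow> (\<forall>\<epsilon>>0. \<exists>n H. is_tuple A n H \<and>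
           (\<forall>w\<in>topspace X. \<bar>(tuple_norm n H w)\<^sup>2 * inverse (p w) - 1\<bar> \<le> \<epsilon>))"
proof -
  obtain C where C: "1 \<le> C" "\<And>w. w \<in> topspace X \<Longrightarrow> p w \<le> C \<and> inverse (p w) \<le> C"
    using compact_space_two_sided_bound[OF assms] by blast
  have pos: "0 < p w" if "w \<in> topspace X" for w
    using assms(3) that by (simp add: strictly_positive_def)
  \<comment> \<open>First the absolute form, where elements of \<open>F_set\<close> are rewritten as
    squared tuple norms.\<close>
  have G: "p \<in> G_set X A \<longleftrightarrow> (\<forall>e>0. \<exists>n H. is_tuple A n H \<and>
      (\<forall>w\<in>topspace X. \<bar>(tuple_norm n H w)\<^sup>2 - p w\<bar> < e))" (is "_ \<longleftrightarrow> ?R")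
  proof
    assume L: "p \<in> G_set X A"
    show ?R
    proof (intro allI impI)
      fix e :: real assume "0 < e"
      then obtain r where rF: "r \<in> F_set X A" and r: "\<forall>w\<in>topspace X. dist (r w) (p w) < e"
        using L unfolding G_set_def uniform_closure_def by blast
      obtain n :: nat and H where "\<forall>i<n. H i \<in> A" "\<forall>w\<in>topspace X. r w = (\<Sum>i<n. (cmod (H i w))\<^sup>2)"
        using rF unfolding F_set_def by auto
      then show "\<exists>n H. is_tuple A n H \<and> (\<forall>w\<in>topspace X. \<bar>(tuple_norm n H w)\<^sup>2 - p w\<bar> < e)"
        using r by (intro exI[of _ n] exI[of _ H]) (auto simp: is_tuple_def tuple_norm_power2 dist_real_def)
    qed
  next
    assume R: ?R
    have "\<exists>r\<in>F_set X A. \<forall>w\<in>topspace X. dist (r w) (p w) < e" if e: "0 < e" for e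
    proof -
      obtain n H where "is_tuple A n H" and H: "\<forall>w\<in>topspace X. \<bar>(tuple_norm n H w)\<^sup>2 - p w\<bar> < e"
        using R e by blast
      then have "(\<lambda>w. (tuple_norm n H w)\<^sup>2) \<in> F_set X A"
        unfolding F_set_def is_tuple_def tuple_norm_power2 by blast
      then show ?thesis
        using H by (intro bexI) (auto simp: dist_real_def)
    qed
    then show "p \<in> G_set X A"
      using assms(2) unfolding G_set_def uniform_closure_def by blast
  qed
  have ratio: "\<bar>t * inverse (p w) - 1\<bar> = \<bar>t - p w\<bar> * inverse (p w)"
    "\<bar>t - p w\<bar> = \<bar>t * inverse (p w) - 1\<bar> * p w" if "w \<in> topspace X" for t w
  proof -
    have "t * inverse (p w) - 1 = (t - p w) * inverse (p w)"
      using pos[OF that] by (simp add: field_simps)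
    then show "\<bar>t * inverse (p w) - 1\<bar> = \<bar>t - p w\<bar> * inverse (p w)"
      using pos[OF that] by (simp add: abs_mult)
    then show "\<bar>t - p w\<bar> = \<bar>t * inverse (p w) - 1\<bar> * p w"
      using pos[OF that] by simp
  qed
  have 1: "\<bar>t * inverse (p w) - 1\<bar> \<le> \<epsilon>"
    if "0 < \<epsilon>" "w \<in> topspace X" "\<bar>t - p w\<bar> < \<epsilon> / C" for t w \<epsilon>
  proof -
    have "\<bar>t - p w\<bar> * inverse (p w) \<le> \<epsilon> / C * C"
      using that C pos[OF that(2)] by (intro mult_mono) auto
    then show ?thesis
      using ratio(1)[OF that(2), of t] C(1) by simp
  qed
  \<comment> \<open>The extra factor 2 in \<open>e / (2 * C)\<close> recovers a strict inequality
    from the non-strict one.\<close>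
  have 2: "\<bar>t - p w\<bar> < e"
    if "0 < e" "w \<in> topspace X" "\<bar>t * inverse (p w) - 1\<bar> \<le> e / (2 * C)" for t w e
  proof -
    have "\<bar>t * inverse (p w) - 1\<bar> * p w \<le> e / (2 * C) * C"
      using that C pos[OF that(2)] by (intro mult_mono) auto
    also have "\<dots> < e"
      using that C(1) by simp
    finally show ?thesis
      using ratio(2)[OF that(2), of t] by simp
  qed
  have 3: "0 < e / C" "0 < e / (2 * C)" if "0 < e" for e
    using that C(1) by auto
  show ?thesis
    unfolding G
  proof (intro iffI allI impI)
    fix \<epsilon> :: real
    assume R: "\<forall>e>0. \<exists>n H. is_tuple A n H \<and> (\<forall>w\<in>topspace X. \<bar>(tuple_norm n H w)\<^sup>2 - p w\<bar> < e)"
      and \<epsilon>: "0 < \<epsilon>"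
    obtain n H where "is_tuple A n H" "\<forall>w\<in>topspace X. \<bar>(tuple_norm n H w)\<^sup>2 - p w\<bar> < \<epsilon> / C"
      using R 3(1)[OF \<epsilon>] by blast
    then show "\<exists>n H. is_tuple A n H \<and> (\<forall>w\<in>topspace X. \<bar>(tuple_norm n H w)\<^sup>2 * inverse (p w) - 1\<bar> \<le> \<epsilon>)"
      using 1[OF \<epsilon>] by blast
  next
    fix e :: real
    assume R: "\<forall>\<epsilon>>0. \<exists>n H. is_tuple A n H \<and>
        (\<forall>w\<in>topspace X. \<bar>(tuple_norm n H w)\<^sup>2 * inverse (p w) - 1\<bar> \<le> \<epsilon>)"
      and e: "0 < e"
    obtain n H where "is_tuple A n H"
        "\<forall>w\<in>topspace X. \<bar>(tuple_norm n H w)\<^sup>2 * inverse (p w) - 1\<bar> \<le> e / (2 * C)"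
      using R 3(2)[OF e] by blast
    then show "\<exists>n H. is_tuple A n H \<and> (\<forall>w\<in>topspace X. \<bar>(tuple_norm n H w)\<^sup>2 - p w\<bar> < e)"
      using 2[OF e] by blast
  qed
qed

section \<open>Unitary and strong subequivalence\<close>

text \<open>Approximating \<open>f\<^sup>2\<close> and \<open>1 / f\<^sup>2\<close> separately
  yields tuples of unrelated lengths, whereas \<open>subequivalence_cond\<close> has one
  \<open>n\<close> for both. Appending zeros leaves the norm unchanged.\<close>

lemma is_tuple_pad:
  assumes "is_tuple A n H" and "n \<le> m" and "(\<lambda>w. 0) \<in> A"
  obtains H' where "is_tuple A m H'" and "\<And>w. tuple_norm m H' w = tuple_norm n H w"
proof
  let ?H = "\<lambda>i. if i < n then H i else (\<lambda>w. 0)"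
  show "is_tuple A m ?H"
    using assms by (auto simp: is_tuple_def)
  fix w
  have "(\<Sum>i<n. (cmod (H i w))\<^sup>2) = (\<Sum>i<m. (cmod (?H i w))\<^sup>2)"
    by (rule sum.mono_neutral_cong_left) (use assms in auto)
  then show "tuple_norm m ?H w = tuple_norm n H w"
    by (simp add: tuple_norm_def L2_set_def)
qed

lemma subequivalence_cond_abs:
  "subequivalence_cond X A f \<epsilon> n \<longleftrightarrow>
     (\<exists>x y. (\<forall>i<n. x i \<in> bimod X A f \<and> y i \<in> bimod X A (\<lambda>w. inverse (f w))) \<and>
        (\<forall>w\<in>topspace X. \<bar>(\<Sum>i<n. (cmod (x i w))\<^sup>2) - 1\<bar> \<le> \<epsilon> \<and>
           \<bar>(\<Sum>i<n. (cmod (y i w))\<^sup>2) - 1\<bar> \<le> \<epsilon>))"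
proof -
  have "\<bar>s - 1\<bar> \<le> \<epsilon> \<longleftrightarrow> 1 - \<epsilon> \<le> s \<and> s \<le> 1 + \<epsilon>" for s :: real
    by linarith
  then show ?thesis
    unfolding subequivalence_cond_def by (simp only: conj_assoc)
qed

text \<open>No roots are taken, so the tolerance stays the same: the equivalence applies at
  \<open>\<epsilon> = 0\<close> for the unitary case and at every positive \<open>\<epsilon>\<close>
  for the strong one.\<close>

lemma subequivalence_cond_iff:
  assumes "strictly_positive X f"
  shows "subequivalence_cond X A f \<epsilon> n \<longleftrightarrow>
    (\<exists>H K. is_tuple A n H \<and> is_tuple A n K \<and>
       (\<forall>w\<in>topspace X. \<bar>(tuple_norm n H w * f w)\<^sup>2 - 1\<bar> \<le> \<epsilon> \<and>
          \<bar>(tuple_norm n K w * inverse (f w))\<^sup>2 - 1\<bar> \<le> \<epsilon>))"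
    (is "?L \<longleftrightarrow> ?R")
proof
  have pos: "0 < f w" if "w \<in> topspace X" for w
    using assms(1) that by (simp add: strictly_positive_def)
  {
    assume ?L
    then obtain x y where x: "\<forall>i<n. x i \<in> bimod X A f"
      and y: "\<forall>i<n. y i \<in> bimod X A (\<lambda>w. inverse (f w))"
      and xy: "\<forall>w\<in>topspace X. \<bar>(\<Sum>i<n. (cmod (x i w))\<^sup>2) - 1\<bar> \<le> \<epsilon> \<and>
        \<bar>(\<Sum>i<n. (cmod (y i w))\<^sup>2) - 1\<bar> \<le> \<epsilon>"
      unfolding subequivalence_cond_abs by blast
    obtain H where H: "is_tuple A n H"
      "\<And>i w. i < n \<Longrightarrow> w \<in> topspace X \<Longrightarrow> x i w = H i w * complex_of_real (f w)"
      using bimod_tupleE[OF x] by blast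
    obtain K where K: "is_tuple A n K"
      "\<And>i w. i < n \<Longrightarrow> w \<in> topspace X \<Longrightarrow> y i w = K i w * complex_of_real (inverse (f w))"
      using bimod_tupleE[OF y] by blast
    show ?R
    proof (intro exI conjI ballI)
      fix w assume w: "w \<in> topspace X"
      have "(\<Sum>i<n. (cmod (x i w))\<^sup>2) = (tuple_norm n H w * f w)\<^sup>2"
        using pos[OF w] H(2)[OF _ w] by (intro tuple_norm_mult_right) auto
      then show "\<bar>(tuple_norm n H w * f w)\<^sup>2 - 1\<bar> \<le> \<epsilon>"
        using xy w by metis
      have "(\<Sum>i<n. (cmod (y i w))\<^sup>2) = (tuple_norm n K w * inverse (f w))\<^sup>2"
        using pos[OF w] K(2)[OF _ w] by (intro tuple_norm_mult_right) auto
      then show "\<bar>(tuple_norm n K w * inverse (f w))\<^sup>2 - 1\<bar> \<le> \<epsilon>"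
        using xy w by metis
    qed (fact H(1) K(1))+
  next
    assume ?R
    then obtain H K where H: "is_tuple A n H" and K: "is_tuple A n K"
      and HK: "\<forall>w\<in>topspace X. \<bar>(tuple_norm n H w * f w)\<^sup>2 - 1\<bar> \<le> \<epsilon> \<and>
          \<bar>(tuple_norm n K w * inverse (f w))\<^sup>2 - 1\<bar> \<le> \<epsilon>"
      by blast
    define x where "x i w = H i w * complex_of_real (f w)" for i w
    define y where "y i w = K i w * complex_of_real (inverse (f w))" for i w
    have "x i \<in> bimod X A f \<and> y i \<in> bimod X A (\<lambda>w. inverse (f w))" if "i < n" for i
      unfolding x_def y_def by (intro conjI tuple_mult_in_bimod[of A n] H K that)
    moreover have "\<bar>(\<Sum>i<n. (cmod (x i w))\<^sup>2) - 1\<bar> \<le> \<epsilon> \<and> \<bar>(\<Sum>i<n. (cmod (y i w))\<^sup>2) - 1\<bar> \<le> \<epsilon>"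
      if w: "w \<in> topspace X" for w
      using tuple_norm_mult_right[of "f w" n x w H] tuple_norm_mult_right[of "inverse (f w)" n y w K]
        pos[OF w] HK w by (simp add: x_def y_def)
    ultimately show ?L
      unfolding subequivalence_cond_abs by blast
  }
qed

text \<open>If \<open>x = h * f\<close> has modulus 1 then \<open>\<bar>h\<bar> = 1 / f\<close>, so
  the coefficient of \<open>x\<close> witnesses \<open>1 / f \<in> P\<close>, and the coefficient of
  \<open>y\<close> witnesses \<open>f \<in> P\<close>.\<close>

lemma unitary_subequivalence_bimodule_iff:
  assumes "strictly_positive X f"
  shows "unitary_subequivalence_bimodule X A f \<longleftrightarrow>
    f \<in> P_set X A \<and> (\<lambda>w. inverse (f w)) \<in> P_set X A"
proof -
  have ratio: "\<bar>(a * b)\<^sup>2 - 1\<bar> \<le> 0 \<longleftrightarrow> inverse b = a" if "0 \<le> a" "0 < b" for a b :: real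
  proof -
    have "\<bar>(a * b)\<^sup>2 - 1\<bar> \<le> 0 \<longleftrightarrow> (a * b)\<^sup>2 = 1\<^sup>2"
      by simp
    also have "\<dots> \<longleftrightarrow> a * b = 1"
      using that by (intro power_eq_iff_eq_base) auto
    also have "\<dots> \<longleftrightarrow> inverse b = a"
      using that by (auto simp: field_simps)
    finally show ?thesis .
  qed
  have eq: "\<bar>(cmod z * f w)\<^sup>2 - 1\<bar> \<le> 0 \<longleftrightarrow> inverse (f w) = cmod z"
    "\<bar>(cmod z * inverse (f w))\<^sup>2 - 1\<bar> \<le> 0 \<longleftrightarrow> f w = cmod z"
    if "w \<in> topspace X" for w z
    using ratio[of "cmod z" "f w"] ratio[of "cmod z" "inverse (f w)"] assms that
    unfolding strictly_positive_def by simp_all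
  have "unitary_subequivalence_bimodule X A f \<longleftrightarrow>
    (\<exists>(H :: nat \<Rightarrow> _) (K :: nat \<Rightarrow> _). (H 0 \<in> A \<and> (\<forall>w\<in>topspace X. inverse (f w) = cmod (H 0 w))) \<and>
       (K 0 \<in> A \<and> (\<forall>w\<in>topspace X. f w = cmod (K 0 w))))"
    unfolding unitary_subequivalence_bimodule_def subequivalence_cond_iff[OF assms]
      tuple_norm_1 is_tuple_1 by (simp only: eq ball_conj_distrib conj_ac cong: ball_cong)
  also have "\<dots> \<longleftrightarrow> f \<in> P_set X A \<and> (\<lambda>w. inverse (f w)) \<in> P_set X A"
    (is "?L \<longleftrightarrow> ?R")
  proof
    assume ?R
    then obtain g h where "g \<in> A" "\<forall>w\<in>topspace X. f w = cmod (g w)"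
      "h \<in> A" "\<forall>w\<in>topspace X. inverse (f w) = cmod (h w)"
      unfolding P_set_def by blast
    then show ?L
      \<comment> \<open>Only index 0 is read, so constant families serve as tuples of length
        1.\<close>
      by (intro exI[of _ "\<lambda>_. h"] exI[of _ "\<lambda>_. g"]) simp
  qed (auto simp: P_set_def)
  finally show ?thesis .
qed

text \<open>The norm of \<open>x\<close> near 1 means that the squared norm of \<open>H\<close> is
  near \<open>1 / f\<^sup>2\<close>, relative to that function; likewise \<open>y\<close> and
  \<open>K\<close> belong to \<open>f\<^sup>2\<close>. The two halves are independent except for the
  common length, which padding supplies.\<close>

lemma strong_subequivalence_bimodule_iff:
  assumes "compact_space X" and "continuous_map X euclideanreal f" and "strictly_positive X f"
    and "(\<lambda>w. 0) \<in> A"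
  shows "strong_subequivalence_bimodule X A f \<longleftrightarrow>
    (\<lambda>w. (f w)\<^sup>2) \<in> G_set X A \<and> (\<lambda>w. inverse ((f w)\<^sup>2)) \<in> G_set X A"
    (is "?L \<longleftrightarrow> ?p \<in> _ \<and> ?q \<in> _")
proof -
  have p: "continuous_map X euclideanreal ?p" "strictly_positive X ?p"
    using assms by (auto simp: strictly_positive_def zero_less_power intro: continuous_map_real_pow)
  have q: "continuous_map X euclideanreal ?q" "strictly_positive X ?q"
    using continuous_map_real_inverse_pos[OF p] p(2) by (auto simp: strictly_positive_def)
  note Gp = G_set_iff[OF assms(1) p, of A]
  note Gq = G_set_iff[OF assms(1) q, of A, unfolded inverse_inverse_eq]
  \<comment> \<open>Distributing the squares brings the inequalities literally into the form of
    \<open>Gp\<close> and \<open>Gq\<close>.\<close>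
  note cond = subequivalence_cond_iff[OF assms(3), unfolded power_mult_distrib power_inverse]
  show ?thesis
  proof
    assume L: ?L
    show "?p \<in> G_set X A \<and> ?q \<in> G_set X A"
      unfolding Gp Gq
    proof (intro conjI allI impI)
      fix \<epsilon> :: real assume "0 < \<epsilon>"
      then obtain n H K where "is_tuple A n H" "is_tuple A n K"
        "\<forall>w\<in>topspace X. \<bar>(tuple_norm n H w)\<^sup>2 * (f w)\<^sup>2 - 1\<bar> \<le> \<epsilon> \<and>
          \<bar>(tuple_norm n K w)\<^sup>2 * inverse ((f w)\<^sup>2) - 1\<bar> \<le> \<epsilon>"
        using L unfolding strong_subequivalence_bimodule_def cond by blast
      then show "\<exists>n H. is_tuple A n H \<and>
          (\<forall>w\<in>topspace X. \<bar>(tuple_norm n H w)\<^sup>2 * inverse ((f w)\<^sup>2) - 1\<bar> \<le> \<epsilon>)"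
        and "\<exists>n H. is_tuple A n H \<and>
          (\<forall>w\<in>topspace X. \<bar>(tuple_norm n H w)\<^sup>2 * (f w)\<^sup>2 - 1\<bar> \<le> \<epsilon>)"
        by blast+
    qed
  next
    assume G: "?p \<in> G_set X A \<and> ?q \<in> G_set X A"
    show ?L
      unfolding strong_subequivalence_bimodule_def cond
    proof (intro allI impI)
      fix \<epsilon> :: real assume "0 < \<epsilon>"
      then obtain k K m H where K: "is_tuple A k K"
          "\<forall>w\<in>topspace X. \<bar>(tuple_norm k K w)\<^sup>2 * inverse ((f w)\<^sup>2) - 1\<bar> \<le> \<epsilon>"
        and H: "is_tuple A m H" "\<forall>w\<in>topspace X. \<bar>(tuple_norm m H w)\<^sup>2 * (f w)\<^sup>2 - 1\<bar> \<le> \<epsilon>"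
        using G unfolding Gp Gq by blast
      obtain K' where "is_tuple A (max k m) K'" "\<And>w. tuple_norm (max k m) K' w = tuple_norm k K w"
        using is_tuple_pad[OF K(1) _ assms(4)] by (metis max.cobounded1)
      moreover obtain H' where "is_tuple A (max k m) H'"
          "\<And>w. tuple_norm (max k m) H' w = tuple_norm m H w"
        using is_tuple_pad[OF H(1) _ assms(4)] by (metis max.cobounded2)
      ultimately show "\<exists>n H K. is_tuple A n H \<and> is_tuple A n K \<and>
          (\<forall>w\<in>topspace X. \<bar>(tuple_norm n H w)\<^sup>2 * (f w)\<^sup>2 - 1\<bar> \<le> \<epsilon> \<and>
             \<bar>(tuple_norm n K w)\<^sup>2 * inverse ((f w)\<^sup>2) - 1\<bar> \<le> \<epsilon>)"
        using K(2) H(2) by (intro exI[of _ "max k m"] exI[of _ H'] exI[of _ K']) simp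
    qed
  qed
qed

theorem proposition6p2:
  fixes X :: "'a topology" and A :: "('a \<Rightarrow> complex) set" and f :: "'a \<Rightarrow> real"
  assumes "uniform_algebra X A"
    and "continuous_map X euclideanreal f"
    and "strictly_positive X f"
  shows "(unitary_subequivalence_bimodule X A f \<longleftrightarrow>
            f \<in> P_set X A \<and> (\<lambda>w. inverse (f w)) \<in> P_set X A)
       \<and> (strong_subequivalence_bimodule X A f \<longleftrightarrow>
            (\<lambda>w. (f w)\<^sup>2) \<in> G_set X A \<and> (\<lambda>w. inverse ((f w)\<^sup>2)) \<in> G_set X A)
       \<and> (f \<in> Q_closure_pos X A \<longleftrightarrow> rank1_strong_morita_bimodule X A f)
       \<and> (f \<in> M_set X A \<longleftrightarrow> strong_morita_bimodule X A f)"
proof (intro conjI)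
  interpret uniform_algebra X A by (fact assms(1))
  show "unitary_subequivalence_bimodule X A f \<longleftrightarrow>
      f \<in> P_set X A \<and> (\<lambda>w. inverse (f w)) \<in> P_set X A"
    by (rule unitary_subequivalence_bimodule_iff[OF assms(3)])
  show "strong_subequivalence_bimodule X A f \<longleftrightarrow>
      (\<lambda>w. (f w)\<^sup>2) \<in> G_set X A \<and> (\<lambda>w. inverse ((f w)\<^sup>2)) \<in> G_set X A"
    by (rule strong_subequivalence_bimodule_iff[OF compact assms(2,3) const])
  \<comment> \<open>Rank 1 restricts the allowed lengths to \<open>{1}\<close>; the last equivalence
    allows all of \<open>UNIV\<close>.\<close>
  show "f \<in> Q_closure_pos X A \<longleftrightarrow> rank1_strong_morita_bimodule X A f"
    unfolding rank1_strong_morita_bimodule_def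
    using Q_closure_pos_iff_near_inverse_pair[OF compact assms(2,3)]
      all_morita_cond_iff_near_inverse_pair[OF compact assms(2,3), of "{1}"] by simp
  show "f \<in> M_set X A \<longleftrightarrow> strong_morita_bimodule X A f"
    unfolding strong_morita_bimodule_def
    using M_set_iff_near_inverse_pair[OF assms(3)]
      all_morita_cond_iff_near_inverse_pair[OF compact assms(2,3), of UNIV] by simp
qed

end
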